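(* Let $G$ be a sofic group and let $H$ be an amenable group. Then the unrestricted wreath product $G\wr\wr H$ is sofic.
   Context: All groups are discrete groups; no countability or finite generation is assumed. **Unrestricted wreath product.** For groups $G$ and $H$, the unrestricted wreath product is the semi-direct product $G\wr\wr H:=\bigl(\prod_{h\in H}G\bigr)\rtimes H$, where the full direct product (all functions $H\to G$) is used and $H$ acts by shifting coordinates. Explicitly, its elements are the pairs $\bigl((g_x)_{x\in H},h\bigr)$ with $g_x\in G$ for every $x\in H$ and $h\in H$, and the multiplication is $$\bigl((g_x)_{x\in H},h\bigr)\cdot\bigl((g'_x)_{x\in H},h'\bigr)=\bigl((g_{h'x}\,g'_x)_{x\in H},\,hh'\bigr).$$ **Normalised Hamming distance.** For a non-empty finite set $F$ and permutations $\alpha,\beta\in\mathrm{Sym}(F)$, put $$d_F(\alpha,\beta):=\frac{1}{|F|}\bigl|\{f\in F\mid \alpha(f)\neq\beta(f)\}\bigr|.$$ **Sofic group.** A group $G$ is sofic if for every finite subset $K\subseteq G$ and every $\varepsilon>0$ there exist a non-empty finite set $F$ and a map $\varphi\colon G\to\mathrm{Sym}(F)$ such that: (s1) for all $k_1,k_2\in K$, $d_F\bigl(\varphi(k_1k_2),\varphi(k_1)\varphi(k_2)\bigr)\leqslant\varepsilon$; (s2) for all distinct $k_1,k_2\in K$, $d_F\bigl(\varphi(k_1),\varphi(k_2)\bigr)\geqslant 1-\varepsilon$. **Amenable group.** A group $H$ is amenable if it satisfies the Følner condition: for every finite subset $S\subseteq H$ and every $\varepsilon>0$ there is a non-empty finite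 subset $F\subseteq H$ with $|F\setminus sF|<\varepsilon|F|$ for all $s\in S$. *)

theory Defs
  imports Complex_Main "HOL-Library.FuncSet" "HOL-Algebra.Coset"
    "HOL-Combinatorics.Permutations"
begin

(* The full direct product of copies of G indexed by H is the set of extensional functions
   from carrier H to carrier G, with no restriction on supports. *)
definition unrestricted_wreath_product ::
    "('a, 'm) monoid_scheme \<Rightarrow> ('b, 'n) monoid_scheme \<Rightarrow> (('b \<Rightarrow> 'a) \<times> 'b) monoid"
    (infixr "\<wr>\<wr>" 70) where
  "G \<wr>\<wr> H =
    \<lparr> carrier = (carrier H \<rightarrow>\<^sub>E carrier G) \<times> carrier H,
      monoid.mult = (\<lambda>(g, h) (g', h').
        (\<lambda>x\<in>carrier H. g (h' \<otimes>\<^bsub>H\<^esub> x) \<otimes>\<^bsub>G\<^esub> g' x, h \<otimes>\<^bsub>H\<^esub> h')),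
      one = (\<lambda>x\<in>carrier H. \<one>\<^bsub>G\<^esub>, \<one>\<^bsub>H\<^esub>) \<rparr>"

definition hamming_dist :: "'a set \<Rightarrow> ('a \<Rightarrow> 'a) \<Rightarrow> ('a \<Rightarrow> 'a) \<Rightarrow> real" where
  "hamming_dist F \<alpha> \<beta> = real (card {f \<in> F. \<alpha> f \<noteq> \<beta> f}) / real (card F)"

(* HOL cannot quantify existentially over types, so F ranges over the finite sets of natural
   numbers. This loses nothing: a bijection from an arbitrary finite set F to such a set carries
   Sym F over isomorphically and preserves the Hamming distance. *)
definition sofic_group :: "('a, 'm) monoid_scheme \<Rightarrow> bool" where
  "sofic_group G \<longleftrightarrow> group G \<and>
    (\<forall>K \<epsilon>. finite K \<and> K \<subseteq> carrier G \<and> \<epsilon> > 0 \<longrightarrow>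
      (\<exists>(F :: nat set) \<phi>. finite F \<and> F \<noteq> {} \<and>
        (\<forall>g \<in> carrier G. \<phi> g permutes F) \<and>
        (\<forall>k\<^sub>1 \<in> K. \<forall>k\<^sub>2 \<in> K.
          hamming_dist F (\<phi> (k\<^sub>1 \<otimes>\<^bsub>G\<^esub> k\<^sub>2)) (\<phi> k\<^sub>1 \<circ> \<phi> k\<^sub>2) \<le> \<epsilon>) \<and>
        (\<forall>k\<^sub>1 \<in> K. \<forall>k\<^sub>2 \<in> K. k\<^sub>1 \<noteq> k\<^sub>2 \<longrightarrow>
          hamming_dist F (\<phi> k\<^sub>1) (\<phi> k\<^sub>2) \<ge> 1 - \<epsilon>)))"

definition amenable_group :: "('a, 'm) monoid_scheme \<Rightarrow> bool" where
  "amenable_group H \<longleftrightarrow> group H \<and>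
    (\<forall>S \<epsilon>. finite S \<and> S \<subseteq> carrier H \<and> \<epsilon> > (0::real) \<longrightarrow>
      (\<exists>F. finite F \<and> F \<noteq> {} \<and> F \<subseteq> carrier H \<and>
        (\<forall>s \<in> S. real (card (F - (s <#\<^bsub>H\<^esub> F))) < \<epsilon> * real (card F))))"

end

theory Submission
  imports Defs "HOL-Algebra.Product_Groups"
begin

text \<open>
  The group \<open>G \<wr>\<wr> H\<close> is an extension of the amenable group \<open>H\<close> by the full direct product of copies
  of \<open>G\<close> indexed by \<open>H\<close>. Two permanence properties of sofic groups therefore suffice: a direct
  product of sofic groups is sofic (\<open>sofic_product_group\<close>), and an extension of an amenable group by
  a sofic kernel is sofic (\<open>sofic_extension_by_amenable\<close>, a theorem of Elek and Szabo).

  Direct products. Soficity only concerns finitely many elements at a time, and finitely many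
  distinct families are already told apart by finitely many coordinates \<open>P\<close>. So \<open>P\<close> is all that has
  to be approximated, although in general no finite set of coordinates determines an element of the
  product. On
  the finite product of approximating sets \<open>A p\<close>, a family acts coordinate by coordinate. The
  multiplicativity errors add up over \<open>P\<close>, and two families that differ at a single coordinate of \<open>P\<close>
  already move almost all points differently.

  Extensions. Let \<open>\<pi> : \<Gamma> \<rightarrow> Q\<close> be surjective with sofic kernel \<open>N\<close>, and let \<open>s\<close> be a set-theoretic
  section of \<open>\<pi>\<close>. Then \<open>\<gamma> s(x) = s(\<pi>(\<gamma>) x) n(\<gamma>, x)\<close> for some \<open>n(\<gamma>, x)\<close> in \<open>N\<close>, which is the
  description of \<open>\<Gamma>\<close> as a group of permutations of \<open>Q \<times> N\<close> that is induced from the regular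
  action of \<open>N\<close>. Replacing \<open>Q\<close> by a Folner set \<open>F\<close>, and the regular action of \<open>N\<close> by a sofic
  approximation \<open>\<psi>\<close> of \<open>N\<close> on a finite set \<open>A\<close>, gives the partial maps
  \<open>(x, a) \<mapsto> (\<pi>(\<gamma>) x, \<psi>(n(\<gamma>, x)) a)\<close> of \<open>F \<times> A\<close>. They are injective and defined for almost all points,
  so they extend to permutations. These are almost multiplicative by the cocycle identity for \<open>n\<close>.
  Two elements with different images in \<open>Q\<close> are separated by the first coordinate, and two distinct
  elements with the same image have different values of \<open>n\<close>, hence are separated by \<open>\<psi>\<close>.
\<close>

section \<open>Sofic approximations on arbitrary finite sets\<close>

text \<open>
  The two conditions on Hamming distances are stated as bounds on the number of bad points, which is
  the form in which they are estimated below. The set \<open>X\<close> may live in any type, so that products of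
  approximating sets can be used directly.
\<close>
definition sofic_approximation ::
    "('a, 'm) monoid_scheme \<Rightarrow> 'a set \<Rightarrow> real \<Rightarrow> 'c set \<Rightarrow> ('a \<Rightarrow> 'c \<Rightarrow> 'c) \<Rightarrow> bool" where
  "sofic_approximation G K \<epsilon> X \<phi> \<longleftrightarrow>
    finite X \<and> X \<noteq> {} \<and> (\<forall>g \<in> carrier G. \<phi> g permutes X) \<and>
    (\<forall>k \<in> K. \<forall>l \<in> K.
      real (card {x \<in> X. \<phi> (k \<otimes>\<^bsub>G\<^esub> l) x \<noteq> \<phi> k (\<phi> l x)}) \<le> \<epsilon> * real (card X)) \<and>
    (\<forall>k \<in> K. \<forall>l \<in> K. k \<noteq> l \<longrightarrow>
      real (card {x \<in> X. \<phi> k x = \<phi> l x}) \<le> \<epsilon> * real (card X))"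

lemma hamming_dist_le_iff:
  assumes "finite X" "X \<noteq> {}"
  shows "hamming_dist X \<alpha> \<beta> \<le> \<epsilon> \<longleftrightarrow> real (card {x \<in> X. \<alpha> x \<noteq> \<beta> x}) \<le> \<epsilon> * real (card X)"
  using assms by (simp add: hamming_dist_def divide_le_eq card_gt_0_iff)

lemma hamming_dist_ge_iff:
  assumes "finite X" "X \<noteq> {}"
  shows "hamming_dist X \<alpha> \<beta> \<ge> 1 - \<epsilon> \<longleftrightarrow> real (card {x \<in> X. \<alpha> x = \<beta> x}) \<le> \<epsilon> * real (card X)"
proof -
  have "card ({x \<in> X. \<alpha> x = \<beta> x} \<union> {x \<in> X. \<alpha> x \<noteq> \<beta> x}) =
      card {x \<in> X. \<alpha> x = \<beta> x} + card {x \<in> X. \<alpha> x \<noteq> \<beta> x}"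
    using assms(1) by (intro card_Un_disjoint) auto
  moreover have "{x \<in> X. \<alpha> x = \<beta> x} \<union> {x \<in> X. \<alpha> x \<noteq> \<beta> x} = X"
    by blast
  ultimately have card: "real (card X) =
      real (card {x \<in> X. \<alpha> x = \<beta> x}) + real (card {x \<in> X. \<alpha> x \<noteq> \<beta> x})"
    by simp
  have "real (card X) > 0"
    using assms by (simp add: card_gt_0_iff)
  then have "hamming_dist X \<alpha> \<beta> \<ge> 1 - \<epsilon> \<longleftrightarrow>
      (1 - \<epsilon>) * real (card X) \<le> real (card {x \<in> X. \<alpha> x \<noteq> \<beta> x})"
    unfolding hamming_dist_def by (rule pos_le_divide_eq)
  also have "\<dots> \<longleftrightarrow> real (card {x \<in> X. \<alpha> x = \<beta> x}) \<le> \<epsilon> * real (card X)"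
    using card by (simp only: left_diff_distrib mult_1) linarith
  finally show ?thesis .
qed

lemma sofic_group_iff:
  "sofic_group G \<longleftrightarrow> group G \<and>
    (\<forall>K \<epsilon>. finite K \<and> K \<subseteq> carrier G \<and> \<epsilon> > 0 \<longrightarrow>
      (\<exists>(F :: nat set) \<phi>. sofic_approximation G K \<epsilon> F \<phi>))"
proof -
  have "(finite F \<and> F \<noteq> {} \<and> (\<forall>g \<in> carrier G. \<phi> g permutes F) \<and>
      (\<forall>k \<in> K. \<forall>l \<in> K. hamming_dist F (\<phi> (k \<otimes>\<^bsub>G\<^esub> l)) (\<phi> k \<circ> \<phi> l) \<le> \<epsilon>) \<and>
      (\<forall>k \<in> K. \<forall>l \<in> K. k \<noteq> l \<longrightarrow> hamming_dist F (\<phi> k) (\<phi> l) \<ge> 1 - \<epsilon>))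
    \<longleftrightarrow> sofic_approximation G K \<epsilon> F \<phi>" for K \<epsilon> \<phi> and F :: "nat set"
    unfolding sofic_approximation_def
    by (cases "finite F \<and> F \<noteq> {}")
      (simp_all add: hamming_dist_le_iff hamming_dist_ge_iff, auto)
  then show ?thesis
    unfolding sofic_group_def by presburger
qed

text \<open>
  Conjugating by an enumeration of \<open>X\<close> preserves all the counts.
\<close>
lemma sofic_approximation_nat:
  fixes X :: "'c set"
  assumes "group G" "K \<subseteq> carrier G" and approx: "sofic_approximation G K \<epsilon> X \<phi>"
  shows "\<exists>(F :: nat set) \<psi>. sofic_approximation G K \<epsilon> F \<psi>"
proof -
  interpret group G by fact
  have X: "finite X" "X \<noteq> {}" and perm: "\<And>g. g \<in> carrier G \<Longrightarrow> \<phi> g permutes X"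
    using approx by (auto simp: sofic_approximation_def)
  obtain b where b: "bij_betw b X {0..<card X}"
    using ex_bij_betw_finite_nat[OF X(1)] by blast
  define \<psi> where "\<psi> g = map_permutation X b (\<phi> g)" for g
  have inj: "inj_on b X" and img: "{0..<card X} = b ` X"
    using b by (auto simp: bij_betw_def)
  have \<psi>_b: "\<psi> g (b x) = b (\<phi> g x)" if "x \<in> X" for g x
    unfolding \<psi>_def using that inj by (simp add: map_permutation_def restrict_id_def)
  have in_X: "\<phi> g x \<in> X" if "g \<in> carrier G" "x \<in> X" for g x
    using perm[OF that(1)] that(2) by (simp add: permutes_in_image)
  have card_b: "card {y \<in> {0..<card X}. P y} = card {x \<in> X. P (b x)}" for P
  proof -
    have "{y \<in> {0..<card X}. P y} = b ` {x \<in> X. P (b x)}"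
      unfolding img by auto
    then show ?thesis
      by (metis (no_types, lifting) card_image inj inj_on_subset mem_Collect_eq subsetI)
  qed
  have "{x \<in> X. \<psi> (k \<otimes>\<^bsub>G\<^esub> l) (b x) \<noteq> \<psi> k (\<psi> l (b x))} =
        {x \<in> X. \<phi> (k \<otimes>\<^bsub>G\<^esub> l) x \<noteq> \<phi> k (\<phi> l x)}" if "k \<in> K" "l \<in> K" for k l
  proof -
    have kl: "k \<in> carrier G" "l \<in> carrier G"
      using that assms(2) by auto
    show ?thesis
      using inj kl by (auto simp: \<psi>_b in_X inj_on_eq_iff)
  qed
  moreover have "{x \<in> X. \<psi> k (b x) = \<psi> l (b x)} = {x \<in> X. \<phi> k x = \<phi> l x}"
    if "k \<in> K" "l \<in> K" for k l
  proof -
    have kl: "k \<in> carrier G" "l \<in> carrier G"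
      using that assms(2) by auto
    show ?thesis
      using inj kl by (auto simp: \<psi>_b in_X inj_on_eq_iff)
  qed
  moreover have "\<psi> g permutes {0..<card X}" if "g \<in> carrier G" for g
    unfolding \<psi>_def using map_permutation_permutes[OF b perm[OF that]] .
  ultimately have "sofic_approximation G K \<epsilon> {0..<card X} \<psi>"
    using approx X unfolding sofic_approximation_def card_b by simp
  then show ?thesis
    by blast
qed

lemma sofic_groupI:
  fixes G :: "('a, 'm) monoid_scheme"
  assumes "group G"
    and "\<And>K \<epsilon>. finite K \<Longrightarrow> K \<subseteq> carrier G \<Longrightarrow> \<epsilon> > 0 \<Longrightarrow>
      \<exists>(X :: 'c set) \<phi>. sofic_approximation G K \<epsilon> X \<phi>"
  shows "sofic_group G"
  unfolding sofic_group_iff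
proof (intro conjI allI impI)
  show "group G" by fact
  fix K :: "'a set" and \<epsilon> :: real
  assume K: "finite K \<and> K \<subseteq> carrier G \<and> \<epsilon> > 0"
  then obtain X :: "'c set" and \<phi> where "sofic_approximation G K \<epsilon> X \<phi>"
    using assms(2) by blast
  then show "\<exists>(F :: nat set) \<psi>. sofic_approximation G K \<epsilon> F \<psi>"
    using sofic_approximation_nat assms(1) K by blast
qed

lemma sofic_group_approximation:
  assumes "sofic_group G" "finite K" "K \<subseteq> carrier G" "\<epsilon> > 0"
  obtains F :: "nat set" and \<phi> where "sofic_approximation G K \<epsilon> F \<phi>"
  using assms unfolding sofic_group_iff by blast

section \<open>Subgroups and direct products\<close>

text \<open>
  Any approximation of \<open>H\<close> can be pulled back along an embedding. Applied to an isomorphism onto the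
  image, this also shows that soficity depends on the isomorphism type only.
\<close>
lemma sofic_group_mon:
  assumes "group G" "f \<in> mon G H" "sofic_group H"
  shows "sofic_group G"
proof (rule sofic_groupI)
  show "group G" by fact
  fix K and \<epsilon> :: real
  assume K: "finite K" "K \<subseteq> carrier G" "\<epsilon> > 0"
  have f: "f \<in> hom G H" "inj_on f (carrier G)"
    using assms by (auto simp: mon_def)
  have "f ` K \<subseteq> carrier H"
    using f(1) K(2) by (auto simp: hom_def)
  then obtain F :: "nat set" and \<phi> where \<phi>: "sofic_approximation H (f ` K) \<epsilon> F \<phi>"
    using sofic_group_approximation[OF assms(3)] K by (metis finite_imageI)
  have "f (k \<otimes>\<^bsub>G\<^esub> l) = f k \<otimes>\<^bsub>H\<^esub> f l" if "k \<in> K" "l \<in> K" for k l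
    using f(1) that K(2) by (meson hom_mult subsetD)
  moreover have "f k \<noteq> f l" if "k \<in> K" "l \<in> K" "k \<noteq> l" for k l
    using f(2) that K(2) by (meson inj_onD subsetD)
  moreover have "f g \<in> carrier H" if "g \<in> carrier G" for g
    using f(1) that by (rule hom_in_carrier)
  ultimately have "sofic_approximation G K \<epsilon> F (\<phi> \<circ> f)"
    using \<phi> unfolding sofic_approximation_def by simp
  then show "\<exists>(F :: nat set) \<psi>. sofic_approximation G K \<epsilon> F \<psi>"
    by blast
qed

text \<open>
  The set on the left is a product again, with the factor \<open>A p\<close> replaced by \<open>B\<close>. So a condition on a
  single coordinate has the same density in the product as in that factor.
\<close>
lemma card_PiE_fibre:
  assumes "finite P" "p \<in> P" "B \<subseteq> A p" "\<And>q. q \<in> P \<Longrightarrow> finite (A q)"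
    and "real (card B) \<le> \<delta> * real (card (A p))"
  shows "real (card {a \<in> PiE P A. a p \<in> B}) \<le> \<delta> * real (card (PiE P A))"
proof -
  have "(\<forall>q\<in>P. a q \<in> A q) \<and> a p \<in> B \<longleftrightarrow> (\<forall>q\<in>P. a q \<in> (A(p := B)) q)" for a
    using assms(2,3) by auto
  then have "{a \<in> PiE P A. a p \<in> B} = PiE P (A(p := B))"
    unfolding PiE_iff set_eq_iff mem_Collect_eq by blast
  then have "card {a \<in> PiE P A. a p \<in> B} = card B * (\<Prod>q\<in>P - {p}. card (A q))"
    using assms(1,2) by (simp add: card_PiE prod.remove[of P p])
  moreover have "card (PiE P A) = card (A p) * (\<Prod>q\<in>P - {p}. card (A q))"
    using assms(1,2) by (simp add: card_PiE prod.remove[of P p])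
  ultimately show ?thesis
    using mult_right_mono[OF assms(5) of_nat_0_le_iff, of "\<Prod>q\<in>P - {p}. card (A q)"]
    by (simp only: of_nat_mult mult.assoc)
qed

text \<open>
  The identity outside the product makes this a permutation of the set in the sense of \<open>permutes\<close>.
\<close>
definition coordinatewise :: "'i set \<Rightarrow> ('i \<Rightarrow> 'c set) \<Rightarrow> ('i \<Rightarrow> 'c \<Rightarrow> 'c) \<Rightarrow> ('i \<Rightarrow> 'c) \<Rightarrow> 'i \<Rightarrow> 'c"
  where "coordinatewise P A \<sigma> a = (if a \<in> PiE P A then \<lambda>p\<in>P. \<sigma> p (a p) else a)"

lemma coordinatewise_permutes:
  assumes "finite P" "\<And>p. p \<in> P \<Longrightarrow> finite (A p)" "\<And>p. p \<in> P \<Longrightarrow> \<sigma> p permutes A p"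
  shows "coordinatewise P A \<sigma> permutes PiE P A"
proof (rule bij_imp_permutes)
  have "coordinatewise P A \<sigma> ` PiE P A \<subseteq> PiE P A"
    using assms(3) by (auto simp: coordinatewise_def PiE_iff permutes_in_image)
  moreover have "inj_on (coordinatewise P A \<sigma>) (PiE P A)"
  proof (rule inj_onI)
    fix a b
    assume ab: "a \<in> PiE P A" "b \<in> PiE P A" "coordinatewise P A \<sigma> a = coordinatewise P A \<sigma> b"
    have "a p = b p" if "p \<in> P" for p
    proof -
      have "\<sigma> p (a p) = \<sigma> p (b p)"
        using fun_cong[OF ab(3), of p] ab that by (simp add: coordinatewise_def)
      then show ?thesis
        using permutes_inj[OF assms(3)[OF that]] by (simp add: inj_eq)
    qed
    then show "a = b"
      using ab(1,2) by (metis PiE_ext)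
  qed
  moreover have "finite (PiE P A)"
    using assms(1,2) by (rule finite_PiE)
  ultimately show "bij_betw (coordinatewise P A \<sigma>) (PiE P A) (PiE P A)"
    by (simp add: bij_betw_def endo_inj_surj)
qed (simp add: coordinatewise_def)

text \<open>
  Finitely many coordinates separate the elements of a finite set \<open>K\<close>. An approximation that sees only
  these coordinates is good enough for \<open>K\<close>, which is why arbitrary index sets are no harder than finite
  ones.
\<close>
proposition sofic_product_group:
  fixes G :: "'i \<Rightarrow> ('a, 'm) monoid_scheme"
  assumes sofic: "\<And>i. i \<in> I \<Longrightarrow> sofic_group (G i)"
  shows "sofic_group (product_group I G)"
proof (rule sofic_groupI)
  show "group (product_group I G)"
    using sofic by (intro product_group) (simp add: sofic_group_def)
  fix K and \<epsilon> :: real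
  assume K: "finite K" "K \<subseteq> carrier (product_group I G)" "\<epsilon> > 0"
  have "\<exists>i\<in>I. k i \<noteq> l i" if "k \<in> K" "l \<in> K" "k \<noteq> l" for k l
  proof (rule ccontr)
    assume "\<not> (\<exists>i\<in>I. k i \<noteq> l i)"
    moreover have "k \<in> (\<Pi>\<^sub>E i\<in>I. carrier (G i))" "l \<in> (\<Pi>\<^sub>E i\<in>I. carrier (G i))"
      using that K(2) by auto
    ultimately have "k = l"
      by (intro PiE_ext) auto
    then show False
      using that(3) by contradiction
  qed
  then obtain sep where sep: "\<And>k l. k \<in> K \<Longrightarrow> l \<in> K \<Longrightarrow> k \<noteq> l \<Longrightarrow> sep k l \<in> I \<and> k (sep k l) \<noteq> l (sep k l)"
    by metis
  define P where "P = (\<lambda>(k, l). sep k l) ` {(k, l). k \<in> K \<and> l \<in> K \<and> k \<noteq> l}"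
  have "finite {(k, l). k \<in> K \<and> l \<in> K \<and> k \<noteq> l}"
    by (rule finite_subset[of _ "K \<times> K"]) (auto simp: K(1))
  then have P: "finite P" "P \<subseteq> I"
    using sep by (auto simp: P_def)
  \<comment> \<open>One error \<open>\<delta>\<close> for each coordinate. The summand 1 covers an empty \<open>P\<close>, which occurs when \<open>K\<close> has at
    most one element; the approximating set is then a single point.\<close>
  define \<delta> where "\<delta> = \<epsilon> / real (card P + 1)"
  have \<delta>: "\<delta> > 0" "\<delta> \<le> \<epsilon>" "real (card P) * \<delta> \<le> \<epsilon>"
    using K(3) by (auto simp: \<delta>_def field_simps)
  have "\<exists>(A :: nat set) \<phi>. sofic_approximation (G p) ((\<lambda>k. k p) ` K) \<delta> A \<phi>" if "p \<in> P" for p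
    by (rule sofic_group_approximation[OF sofic, of p "(\<lambda>k. k p) ` K" \<delta>])
      (use that P K \<delta> in \<open>auto simp: PiE_iff\<close>)
  then obtain A :: "'i \<Rightarrow> nat set" and \<phi>
    where \<phi>: "\<And>p. p \<in> P \<Longrightarrow> sofic_approximation (G p) ((\<lambda>k. k p) ` K) \<delta> (A p) (\<phi> p)"
    by metis
  define X where "X = PiE P A"
  define \<psi> where "\<psi> g = coordinatewise P A (\<lambda>p. \<phi> p (g p))" for g
  have A: "finite (A p)" "A p \<noteq> {}" "\<And>g. g \<in> carrier (G p) \<Longrightarrow> \<phi> p g permutes A p" if "p \<in> P" for p
    using \<phi>[OF that] by (auto simp: sofic_approximation_def)
  have X: "finite X" "X \<noteq> {}"
    using P(1) A(1,2) by (auto simp: X_def PiE_eq_empty_iff intro!: finite_PiE)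
  have fibre: "real (card {a \<in> X. a p \<in> B}) \<le> \<delta> * real (card X)"
    if "p \<in> P" "B \<subseteq> A p" "real (card B) \<le> \<delta> * real (card (A p))" for p B
    unfolding X_def using P(1) that(1,2) A(1) that(3) by (rule card_PiE_fibre)
  have perm: "\<psi> g permutes X" if "g \<in> carrier (product_group I G)" for g
    unfolding \<psi>_def X_def
    by (rule coordinatewise_permutes) (use P A that in \<open>auto simp: PiE_iff\<close>)
  have \<psi>_apply: "\<psi> g a = (\<lambda>p\<in>P. \<phi> p (g p) (a p))" if "a \<in> X" for g a
    using that by (simp add: \<psi>_def X_def coordinatewise_def)
  have mult: "real (card {a \<in> X. \<psi> (k \<otimes>\<^bsub>product_group I G\<^esub> l) a \<noteq> \<psi> k (\<psi> l a)}) \<le> \<epsilon> * real (card X)"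
    if kl: "k \<in> K" "l \<in> K" for k l
  proof -
    define B where "B p = {y \<in> A p. \<phi> p (k p \<otimes>\<^bsub>G p\<^esub> l p) y \<noteq> \<phi> p (k p) (\<phi> p (l p) y)}" for p
    have "\<psi> (k \<otimes>\<^bsub>product_group I G\<^esub> l) a = \<psi> k (\<psi> l a)"
      if a: "a \<in> X" "\<forall>p\<in>P. a p \<notin> B p" for a
    proof -
      have "\<psi> l a \<in> X"
        using perm[of l] kl K(2) a(1) by (meson permutes_in_image subsetD)
      then show ?thesis
        using a P(2) by (auto simp: \<psi>_apply B_def X_def PiE_iff intro!: restrict_ext)
    qed
    then have "{a \<in> X. \<psi> (k \<otimes>\<^bsub>product_group I G\<^esub> l) a \<noteq> \<psi> k (\<psi> l a)} \<subseteq> (\<Union>p\<in>P. {a \<in> X. a p \<in> B p})"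
      by blast
    then have "card {a \<in> X. \<psi> (k \<otimes>\<^bsub>product_group I G\<^esub> l) a \<noteq> \<psi> k (\<psi> l a)}
        \<le> card (\<Union>p\<in>P. {a \<in> X. a p \<in> B p})"
      using P(1) X(1) by (intro card_mono) auto
    also have "\<dots> \<le> (\<Sum>p\<in>P. card {a \<in> X. a p \<in> B p})"
      by (rule card_UN_le[OF P(1)])
    finally have "real (card {a \<in> X. \<psi> (k \<otimes>\<^bsub>product_group I G\<^esub> l) a \<noteq> \<psi> k (\<psi> l a)})
        \<le> (\<Sum>p\<in>P. real (card {a \<in> X. a p \<in> B p}))"
      by (simp only: of_nat_le_iff flip: of_nat_sum)
    also have "\<dots> \<le> (\<Sum>p\<in>P. \<delta> * real (card X))"
    proof (intro sum_mono fibre)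
      fix p assume "p \<in> P"
      then show "real (card (B p)) \<le> \<delta> * real (card (A p))"
        using \<phi>[of p] kl unfolding B_def sofic_approximation_def by blast
    qed (auto simp: B_def)
    also have "\<dots> = real (card P) * \<delta> * real (card X)"
      by simp
    also have "\<dots> \<le> \<epsilon> * real (card X)"
      using \<delta>(3) by (intro mult_right_mono) auto
    finally show ?thesis .
  qed
  have free: "real (card {a \<in> X. \<psi> k a = \<psi> l a}) \<le> \<epsilon> * real (card X)"
    if kl: "k \<in> K" "l \<in> K" "k \<noteq> l" for k l
  proof -
    define p where "p = sep k l"
    have p: "p \<in> P" "k p \<noteq> l p"
      using kl sep[OF kl] by (auto simp: p_def P_def)
    define B where "B = {y \<in> A p. \<phi> p (k p) y = \<phi> p (l p) y}"
    have "\<phi> p (k p) (a p) = \<phi> p (l p) (a p)" if "a \<in> X" "\<psi> k a = \<psi> l a" for a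
      using fun_cong[OF that(2), of p] that(1) p(1) by (simp add: \<psi>_apply)
    then have "{a \<in> X. \<psi> k a = \<psi> l a} \<subseteq> {a \<in> X. a p \<in> B}"
      using p(1) by (auto simp: B_def X_def)
    then have "real (card {a \<in> X. \<psi> k a = \<psi> l a}) \<le> real (card {a \<in> X. a p \<in> B})"
      using X(1) by (simp add: card_mono)
    also have "\<dots> \<le> \<delta> * real (card X)"
      using \<phi>[OF p(1)] p kl
      by (intro fibre) (auto simp: B_def sofic_approximation_def)
    also have "\<dots> \<le> \<epsilon> * real (card X)"
      using \<delta>(2) by (intro mult_right_mono) auto
    finally show ?thesis .
  qed
  have "sofic_approximation (product_group I G) K \<epsilon> X \<psi>"
    unfolding sofic_approximation_def using X perm mult free by blast
  then show "\<exists>(X :: ('i \<Rightarrow> nat) set) \<psi>. sofic_approximation (product_group I G) K \<epsilon> X \<psi>"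
    by blast
qed

section \<open>Extensions with amenable quotient\<close>

text \<open>
  In a finite set, the complements of the domain and of the range of a partial injection have equally
  many elements, so any bijection between them completes it.
\<close>
lemma permutation_extending_partial_injection:
  assumes "finite X" "D \<subseteq> X" "inj_on f D" "f ` D \<subseteq> X"
  shows "\<exists>p. p permutes X \<and> (\<forall>x\<in>D. p x = f x)"
proof -
  have "card (X - D) = card (X - f ` D)"
    using assms by (simp add: card_Diff_subset card_image finite_subset)
  then obtain h where h: "bij_betw h (X - D) (X - f ` D)"
    using finite_same_card_bij assms(1) by (metis finite_Diff)
  define p where "p x = (if x \<in> D then f x else if x \<in> X then h x else x)" for x
  have "bij_betw p D (f ` D)"
    using assms(3) by (auto simp: bij_betw_def p_def inj_on_def)
  moreover have "bij_betw p (X - D) (X - f ` D)"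
    using h by (rule bij_betw_cong[THEN iffD1, rotated]) (simp add: p_def)
  ultimately have "bij_betw p (D \<union> (X - D)) (f ` D \<union> (X - f ` D))"
    by (rule bij_betw_combine) blast
  moreover have "D \<union> (X - D) = X" "f ` D \<union> (X - f ` D) = X"
    using assms by auto
  ultimately have "p permutes X"
    using assms(2) by (intro bij_imp_permutes) (auto simp: p_def)
  then show ?thesis
    by (auto simp: p_def)
qed

text \<open>
  The approximation lives on a Folner set of the quotient times an approximating set of the kernel, and
  imitates the action of \<open>\<Gamma>\<close> that is induced from its kernel. Only the values of the cocycle on the
  Folner set matter, and they form a finite subset of the kernel. This forces the order of the choices:
  the Folner set is chosen before the approximation of the kernel.
\<close>
theorem sofic_extension_by_amenable:
  fixes \<Gamma> :: "('a, 'm) monoid_scheme" and Q :: "('b, 'n) monoid_scheme"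
  assumes "group \<Gamma>" and \<pi>: "\<pi> \<in> epi \<Gamma> Q"
    and sofic: "sofic_group (\<Gamma>\<lparr>carrier := kernel \<Gamma> Q \<pi>\<rparr>)" and amenable: "amenable_group Q"
  shows "sofic_group \<Gamma>"
proof (rule sofic_groupI)
  show "group \<Gamma>" by fact
  fix K and \<epsilon> :: real
  assume K: "finite K" "K \<subseteq> carrier \<Gamma>" "\<epsilon> > 0"
  have "group Q"
    using amenable by (simp add: amenable_group_def)
  interpret group_hom \<Gamma> Q \<pi>
    using \<open>group \<Gamma>\<close> \<open>group Q\<close> \<pi> by (simp add: group_hom_def group_hom_axioms_def epi_def)
  have "\<exists>\<gamma>\<in>carrier \<Gamma>. \<pi> \<gamma> = x" if "x \<in> carrier Q" for x
  proof -
    have "x \<in> \<pi> ` carrier \<Gamma>"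
      using \<pi> that by (simp add: epi_def)
    then show ?thesis
      by blast
  qed
  then obtain s where s: "\<And>x. x \<in> carrier Q \<Longrightarrow> s x \<in> carrier \<Gamma>"
      "\<And>x. x \<in> carrier Q \<Longrightarrow> \<pi> (s x) = x"
    by metis
  \<comment> \<open>The cocycle, determined by \<open>\<gamma> s(x) = s(\<pi>(\<gamma>) x) n(\<gamma>, x)\<close>.\<close>
  define n where "n \<gamma> x = inv\<^bsub>\<Gamma>\<^esub> s (\<pi> \<gamma> \<otimes>\<^bsub>Q\<^esub> x) \<otimes>\<^bsub>\<Gamma>\<^esub> (\<gamma> \<otimes>\<^bsub>\<Gamma>\<^esub> s x)" for \<gamma> x
  have n_kernel: "n \<gamma> x \<in> kernel \<Gamma> Q \<pi>" if "\<gamma> \<in> carrier \<Gamma>" "x \<in> carrier Q" for \<gamma> x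
    using that s by (simp add: n_def kernel_def)
  have n_mult: "n (\<gamma> \<otimes>\<^bsub>\<Gamma>\<^esub> \<gamma>') x = n \<gamma> (\<pi> \<gamma>' \<otimes>\<^bsub>Q\<^esub> x) \<otimes>\<^bsub>\<Gamma>\<^esub> n \<gamma>' x"
    if "\<gamma> \<in> carrier \<Gamma>" "\<gamma>' \<in> carrier \<Gamma>" "x \<in> carrier Q" for \<gamma> \<gamma>' x
  proof -
    define t u v where "t = s (\<pi> \<gamma> \<otimes>\<^bsub>Q\<^esub> (\<pi> \<gamma>' \<otimes>\<^bsub>Q\<^esub> x))" and "u = s (\<pi> \<gamma>' \<otimes>\<^bsub>Q\<^esub> x)" and "v = s x"
    have "t \<in> carrier \<Gamma>" "u \<in> carrier \<Gamma>" "v \<in> carrier \<Gamma>"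
      using that s by (auto simp: t_def u_def v_def)
    moreover from this have "u \<otimes>\<^bsub>\<Gamma>\<^esub> (inv\<^bsub>\<Gamma>\<^esub> u \<otimes>\<^bsub>\<Gamma>\<^esub> w) = w" if "w \<in> carrier \<Gamma>" for w
      using that by (simp flip: G.m_assoc)
    ultimately have "inv\<^bsub>\<Gamma>\<^esub> t \<otimes>\<^bsub>\<Gamma>\<^esub> (\<gamma> \<otimes>\<^bsub>\<Gamma>\<^esub> \<gamma>' \<otimes>\<^bsub>\<Gamma>\<^esub> v) =
        (inv\<^bsub>\<Gamma>\<^esub> t \<otimes>\<^bsub>\<Gamma>\<^esub> (\<gamma> \<otimes>\<^bsub>\<Gamma>\<^esub> u)) \<otimes>\<^bsub>\<Gamma>\<^esub> (inv\<^bsub>\<Gamma>\<^esub> u \<otimes>\<^bsub>\<Gamma>\<^esub> (\<gamma>' \<otimes>\<^bsub>\<Gamma>\<^esub> v))"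
      using that by (simp add: G.m_assoc)
    then show ?thesis
      using that by (simp add: n_def t_def u_def v_def H.m_assoc)
  qed
  have n_inj: "n \<gamma> x \<noteq> n \<gamma>' x"
    if "\<gamma> \<in> carrier \<Gamma>" "\<gamma>' \<in> carrier \<Gamma>" "x \<in> carrier Q" "\<pi> \<gamma> = \<pi> \<gamma>'" "\<gamma> \<noteq> \<gamma>'" for \<gamma> \<gamma>' x
    using that s by (simp add: n_def)
  \<comment> \<open>Almost multiplicativity on \<open>K\<close> also involves the maps of the products of two elements of \<open>K\<close>.\<close>
  define K' where "K' = K \<union> (\<lambda>(k, l). k \<otimes>\<^bsub>\<Gamma>\<^esub> l) ` (K \<times> K)"
  have K': "finite K'" "K' \<subseteq> carrier \<Gamma>" "K \<subseteq> K'" "\<And>k l. k \<in> K \<Longrightarrow> l \<in> K \<Longrightarrow> k \<otimes>\<^bsub>\<Gamma>\<^esub> l \<in> K'"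
    using K(1,2) by (auto simp: K'_def)
  \<comment> \<open>Each estimate has three sources of error: two elements that may lead out of the Folner set, and
    the approximation of the kernel.\<close>
  define \<delta> where "\<delta> = \<epsilon> / 3"
  have \<delta>: "\<delta> > 0" "3 * \<delta> = \<epsilon>"
    using K(3) by (auto simp: \<delta>_def)
  have "finite ((\<lambda>k. inv\<^bsub>Q\<^esub> \<pi> k) ` K')" "(\<lambda>k. inv\<^bsub>Q\<^esub> \<pi> k) ` K' \<subseteq> carrier Q"
    using K'(1,2) by auto
  with amenable \<delta>(1) obtain F where F: "finite F" "F \<noteq> {}" "F \<subseteq> carrier Q"
    and Folner: "\<forall>q \<in> (\<lambda>k. inv\<^bsub>Q\<^esub> \<pi> k) ` K'. real (card (F - (q <#\<^bsub>Q\<^esub> F))) < \<delta> * real (card F)"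
    unfolding amenable_group_def by metis
  \<comment> \<open>The inverses enter because \<open>\<pi>(k) x\<close> lies outside \<open>F\<close> exactly when \<open>x\<close> lies outside \<open>\<pi>(k)\<inverse> F\<close>.\<close>
  have leave: "real (card {x \<in> F. \<pi> k \<otimes>\<^bsub>Q\<^esub> x \<notin> F}) \<le> \<delta> * real (card F)" if "k \<in> K'" for k
  proof -
    have k: "\<pi> k \<in> carrier Q"
      using that K'(2) by auto
    have "x \<notin> inv\<^bsub>Q\<^esub> \<pi> k <#\<^bsub>Q\<^esub> F" if x: "x \<in> F" "\<pi> k \<otimes>\<^bsub>Q\<^esub> x \<notin> F" for x
    proof
      assume "x \<in> inv\<^bsub>Q\<^esub> \<pi> k <#\<^bsub>Q\<^esub> F"
      then obtain y where "y \<in> F" "x = inv\<^bsub>Q\<^esub> \<pi> k \<otimes>\<^bsub>Q\<^esub> y"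
        by (auto simp: l_coset_def)
      then have "\<pi> k \<otimes>\<^bsub>Q\<^esub> x \<in> F"
        using k F(3) by (simp add: subset_iff flip: H.m_assoc)
      then show False
        using x(2) by contradiction
    qed
    then have "card {x \<in> F. \<pi> k \<otimes>\<^bsub>Q\<^esub> x \<notin> F} \<le> card (F - (inv\<^bsub>Q\<^esub> \<pi> k <#\<^bsub>Q\<^esub> F))"
      using F(1) by (intro card_mono) auto
    moreover have "real (card (F - (inv\<^bsub>Q\<^esub> \<pi> k <#\<^bsub>Q\<^esub> F))) < \<delta> * real (card F)"
      using Folner that by blast
    ultimately show ?thesis
      by linarith
  qed
  define L where "L = (\<lambda>(k, x). n k x) ` (K' \<times> F)"
  have L: "finite L" "L \<subseteq> kernel \<Gamma> Q \<pi>" and n_L: "\<And>k x. k \<in> K' \<Longrightarrow> x \<in> F \<Longrightarrow> n k x \<in> L"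
    using K'(1,2) F(1,3) n_kernel by (auto simp: L_def)
  obtain A :: "nat set" and \<psi>
    where \<psi>: "sofic_approximation (\<Gamma>\<lparr>carrier := kernel \<Gamma> Q \<pi>\<rparr>) L \<delta> A \<psi>"
    using sofic_group_approximation[OF sofic L(1) _ \<delta>(1)] L(2) by auto
  have A: "finite A" "A \<noteq> {}" "\<And>g. g \<in> kernel \<Gamma> Q \<pi> \<Longrightarrow> \<psi> g permutes A"
    and \<psi>_mult: "\<And>g h. g \<in> L \<Longrightarrow> h \<in> L \<Longrightarrow>
      real (card {a \<in> A. \<psi> (g \<otimes>\<^bsub>\<Gamma>\<^esub> h) a \<noteq> \<psi> g (\<psi> h a)}) \<le> \<delta> * real (card A)"
    and \<psi>_free: "\<And>g h. g \<in> L \<Longrightarrow> h \<in> L \<Longrightarrow> g \<noteq> h \<Longrightarrow>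
      real (card {a \<in> A. \<psi> g a = \<psi> h a}) \<le> \<delta> * real (card A)"
    using \<psi> by (auto simp: sofic_approximation_def)
  define X where "X = F \<times> A"
  have X: "finite X" "X \<noteq> {}" "card X = card F * card A"
    using F(1,2) A(1,2) by (auto simp: X_def card_cartesian_product)
  have "\<exists>p. p permutes X \<and> (\<forall>x\<in>F. \<forall>a\<in>A. \<pi> \<gamma> \<otimes>\<^bsub>Q\<^esub> x \<in> F \<longrightarrow> p (x, a) = (\<pi> \<gamma> \<otimes>\<^bsub>Q\<^esub> x, \<psi> (n \<gamma> x) a))"
    if \<gamma>: "\<gamma> \<in> carrier \<Gamma>" for \<gamma>
  proof -
    define D where "D = {x \<in> F. \<pi> \<gamma> \<otimes>\<^bsub>Q\<^esub> x \<in> F} \<times> A"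
    define f where "f = (\<lambda>(x, a). (\<pi> \<gamma> \<otimes>\<^bsub>Q\<^esub> x, \<psi> (n \<gamma> x) a))"
    have perm: "\<psi> (n \<gamma> x) permutes A" if "x \<in> F" for x
      using A(3) n_kernel \<gamma> F(3) that by blast
    have "f ` D \<subseteq> X"
      using perm by (auto simp: f_def D_def X_def permutes_in_image)
    moreover have "inj_on f D"
    proof (rule inj_onI)
      fix u v
      assume uv: "u \<in> D" "v \<in> D" "f u = f v"
      obtain x a y b where [simp]: "u = (x, a)" "v = (y, b)"
        by (cases u, cases v)
      have "x = y"
        using uv \<gamma> F(3) by (auto simp: f_def D_def subset_iff)
      moreover from this have "a = b"
        using uv permutes_inj[OF perm[of x]] by (auto simp: f_def D_def inj_eq)
      ultimately show "u = v"
        by simp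
    qed
    moreover have "D \<subseteq> X"
      by (auto simp: D_def X_def)
    ultimately obtain p where "p permutes X" "\<forall>u\<in>D. p u = f u"
      using permutation_extending_partial_injection[OF X(1)] by metis
    then show ?thesis
      by (auto simp: D_def f_def)
  qed
  then obtain \<Phi> where perm: "\<And>\<gamma>. \<gamma> \<in> carrier \<Gamma> \<Longrightarrow> \<Phi> \<gamma> permutes X"
    and \<Phi>: "\<And>\<gamma> x a. \<gamma> \<in> carrier \<Gamma> \<Longrightarrow> x \<in> F \<Longrightarrow> a \<in> A \<Longrightarrow> \<pi> \<gamma> \<otimes>\<^bsub>Q\<^esub> x \<in> F \<Longrightarrow>
      \<Phi> \<gamma> (x, a) = (\<pi> \<gamma> \<otimes>\<^bsub>Q\<^esub> x, \<psi> (n \<gamma> x) a)"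
    by metis
  \<comment> \<open>Bad points either have a first coordinate that one of two elements moves out of \<open>F\<close>, or lie in a
    small set \<open>C x\<close> of the fibre over \<open>x\<close>.\<close>
  have count: "real (card B) \<le> \<epsilon> * real (card X)"
    if B: "B \<subseteq> {x \<in> F. \<pi> k \<otimes>\<^bsub>Q\<^esub> x \<notin> F} \<times> A \<union> {x \<in> F. \<pi> l \<otimes>\<^bsub>Q\<^esub> x \<notin> F} \<times> A \<union> Sigma F C"
      and kl: "k \<in> K'" "l \<in> K'"
      and C: "\<And>x. x \<in> F \<Longrightarrow> C x \<subseteq> A" "\<And>x. x \<in> F \<Longrightarrow> real (card (C x)) \<le> \<delta> * real (card A)"
    for B k l C
  proof -
    have fin: "finite (C x)" if "x \<in> F" for x
      using C(1)[OF that] A(1) by (rule finite_subset)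
    have "card B \<le> card ({x \<in> F. \<pi> k \<otimes>\<^bsub>Q\<^esub> x \<notin> F} \<times> A \<union> {x \<in> F. \<pi> l \<otimes>\<^bsub>Q\<^esub> x \<notin> F} \<times> A \<union> Sigma F C)"
      using B F(1) A(1) fin by (intro card_mono) auto
    also have "\<dots> \<le> card ({x \<in> F. \<pi> k \<otimes>\<^bsub>Q\<^esub> x \<notin> F} \<times> A \<union> {x \<in> F. \<pi> l \<otimes>\<^bsub>Q\<^esub> x \<notin> F} \<times> A) + card (Sigma F C)"
      by (rule card_Un_le)
    also have "\<dots> \<le> card ({x \<in> F. \<pi> k \<otimes>\<^bsub>Q\<^esub> x \<notin> F} \<times> A) + card ({x \<in> F. \<pi> l \<otimes>\<^bsub>Q\<^esub> x \<notin> F} \<times> A) + card (Sigma F C)"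
      by (intro add_right_mono card_Un_le)
    also have "\<dots> = card {x \<in> F. \<pi> k \<otimes>\<^bsub>Q\<^esub> x \<notin> F} * card A + card {x \<in> F. \<pi> l \<otimes>\<^bsub>Q\<^esub> x \<notin> F} * card A
        + (\<Sum>x\<in>F. card (C x))"
      using F(1) fin by (simp add: card_cartesian_product)
    finally have "real (card B) \<le> real (card {x \<in> F. \<pi> k \<otimes>\<^bsub>Q\<^esub> x \<notin> F}) * real (card A)
        + real (card {x \<in> F. \<pi> l \<otimes>\<^bsub>Q\<^esub> x \<notin> F}) * real (card A) + (\<Sum>x\<in>F. real (card (C x)))"
      by (simp only: of_nat_le_iff flip: of_nat_add of_nat_mult of_nat_sum)
    also have "\<dots> \<le> \<delta> * real (card F) * real (card A) + \<delta> * real (card F) * real (card A)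
        + (\<Sum>x\<in>F. \<delta> * real (card A))"
      using leave kl C(2) by (intro add_mono mult_right_mono sum_mono) auto
    also have "\<dots> = 3 * \<delta> * real (card X)"
      by (simp add: X(3) algebra_simps)
    finally show ?thesis
      by (simp add: \<delta>(2))
  qed
  have mult: "real (card {w \<in> X. \<Phi> (k \<otimes>\<^bsub>\<Gamma>\<^esub> l) w \<noteq> \<Phi> k (\<Phi> l w)}) \<le> \<epsilon> * real (card X)"
    if kl: "k \<in> K" "l \<in> K" for k l
  proof -
    have kl': "k \<in> carrier \<Gamma>" "l \<in> carrier \<Gamma>" "l \<in> K'" "k \<otimes>\<^bsub>\<Gamma>\<^esub> l \<in> K'"
      using kl K(2) K'(3,4) by auto
    define C where "C x = (if \<pi> l \<otimes>\<^bsub>Q\<^esub> x \<in> F then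
      {a \<in> A. \<psi> (n k (\<pi> l \<otimes>\<^bsub>Q\<^esub> x) \<otimes>\<^bsub>\<Gamma>\<^esub> n l x) a \<noteq> \<psi> (n k (\<pi> l \<otimes>\<^bsub>Q\<^esub> x)) (\<psi> (n l x) a)} else {})" for x
    have "\<Phi> (k \<otimes>\<^bsub>\<Gamma>\<^esub> l) (x, a) = \<Phi> k (\<Phi> l (x, a))"
      if "x \<in> F" "a \<in> A" "\<pi> (k \<otimes>\<^bsub>\<Gamma>\<^esub> l) \<otimes>\<^bsub>Q\<^esub> x \<in> F" "\<pi> l \<otimes>\<^bsub>Q\<^esub> x \<in> F" "a \<notin> C x" for x a
    proof -
      have x: "x \<in> carrier Q"
        using that(1) F(3) by blast
      have a: "\<psi> (n l x) a \<in> A"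
        using A(3)[OF n_kernel[OF kl'(2) x]] that(2) by (simp add: permutes_in_image)
      have "\<Phi> (k \<otimes>\<^bsub>\<Gamma>\<^esub> l) (x, a) = (\<pi> k \<otimes>\<^bsub>Q\<^esub> (\<pi> l \<otimes>\<^bsub>Q\<^esub> x), \<psi> (n k (\<pi> l \<otimes>\<^bsub>Q\<^esub> x) \<otimes>\<^bsub>\<Gamma>\<^esub> n l x) a)"
        using \<Phi>[OF _ that(1,2,3)] kl' x by (simp add: n_mult H.m_assoc)
      also have "\<dots> = (\<pi> k \<otimes>\<^bsub>Q\<^esub> (\<pi> l \<otimes>\<^bsub>Q\<^esub> x), \<psi> (n k (\<pi> l \<otimes>\<^bsub>Q\<^esub> x)) (\<psi> (n l x) a))"
        using that(2,4,5) by (simp add: C_def)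
      also have "\<dots> = \<Phi> k (\<Phi> l (x, a))"
        using that(3) kl' x by (simp add: \<Phi> that(1,2,4) a H.m_assoc)
      finally show ?thesis .
    qed
    then have "{w \<in> X. \<Phi> (k \<otimes>\<^bsub>\<Gamma>\<^esub> l) w \<noteq> \<Phi> k (\<Phi> l w)} \<subseteq>
        {x \<in> F. \<pi> (k \<otimes>\<^bsub>\<Gamma>\<^esub> l) \<otimes>\<^bsub>Q\<^esub> x \<notin> F} \<times> A \<union> {x \<in> F. \<pi> l \<otimes>\<^bsub>Q\<^esub> x \<notin> F} \<times> A \<union> Sigma F C"
      unfolding X_def by blast
    then show ?thesis
    proof (rule count)
      fix x assume x: "x \<in> F"
      show "C x \<subseteq> A"
        by (auto simp: C_def)
      show "real (card (C x)) \<le> \<delta> * real (card A)"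
        using \<psi>_mult n_L K'(3) kl kl' x \<delta>(1) by (auto simp: C_def subset_iff)
    qed (use kl' in auto)
  qed
  \<comment> \<open>Where both maps are given by the formula, they can agree only if \<open>\<pi> k = \<pi> l\<close>. The cocycle values
    are then distinct elements of the kernel.\<close>
  have free: "real (card {w \<in> X. \<Phi> k w = \<Phi> l w}) \<le> \<epsilon> * real (card X)"
    if kl: "k \<in> K" "l \<in> K" "k \<noteq> l" for k l
  proof -
    have kl': "k \<in> carrier \<Gamma>" "l \<in> carrier \<Gamma>" "k \<in> K'" "l \<in> K'"
      using kl K(2) K'(3) by auto
    define C where "C x = (if \<pi> k = \<pi> l then {a \<in> A. \<psi> (n k x) a = \<psi> (n l x) a} else {})" for x
    have "a \<in> C x" if "x \<in> F" "a \<in> A" "\<pi> k \<otimes>\<^bsub>Q\<^esub> x \<in> F" "\<pi> l \<otimes>\<^bsub>Q\<^esub> x \<in> F" "\<Phi> k (x, a) = \<Phi> l (x, a)" for x a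
      using that kl' F(3) by (auto simp: \<Phi> C_def subset_iff)
    then have "{w \<in> X. \<Phi> k w = \<Phi> l w} \<subseteq>
        {x \<in> F. \<pi> k \<otimes>\<^bsub>Q\<^esub> x \<notin> F} \<times> A \<union> {x \<in> F. \<pi> l \<otimes>\<^bsub>Q\<^esub> x \<notin> F} \<times> A \<union> Sigma F C"
      unfolding X_def by blast
    then show ?thesis
    proof (rule count)
      fix x assume x: "x \<in> F"
      show "C x \<subseteq> A"
        by (auto simp: C_def)
      have "n k x \<noteq> n l x" if "\<pi> k = \<pi> l"
        using n_inj kl' kl(3) that x F(3) by blast
      then show "real (card (C x)) \<le> \<delta> * real (card A)"
        using \<psi>_free n_L kl' x \<delta>(1) by (auto simp: C_def)
    qed (use kl' in auto)
  qed
  have "sofic_approximation \<Gamma> K \<epsilon> X \<Phi>"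
    unfolding sofic_approximation_def using X(1,2) perm mult free by blast
  then show "\<exists>(X :: ('b \<times> nat) set) \<Phi>. sofic_approximation \<Gamma> K \<epsilon> X \<Phi>"
    by blast
qed

section \<open>The unrestricted wreath product\<close>

text \<open>
  The left inverse of \<open>(g, h)\<close> has first component \<open>x \<mapsto> g(h\<inverse> x)\<inverse>\<close>: multiplication evaluates the
  left factor at \<open>h x\<close>, which cancels the shift.
\<close>
lemma group_unrestricted_wreath_product:
  assumes "group G" "group H"
  shows "group (G \<wr>\<wr> H)"
proof -
  interpret G: group G by fact
  interpret H: group H by fact
  show ?thesis
  proof (rule groupI)
    fix u assume "u \<in> carrier (G \<wr>\<wr> H)"
    then obtain g h where u: "u = (g, h)" "g \<in> carrier H \<rightarrow>\<^sub>E carrier G" "h \<in> carrier H"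
      by (auto simp: unrestricted_wreath_product_def)
    let ?v = "(\<lambda>x\<in>carrier H. inv\<^bsub>G\<^esub> g (inv\<^bsub>H\<^esub> h \<otimes>\<^bsub>H\<^esub> x), inv\<^bsub>H\<^esub> h)"
    have "?v \<in> carrier (G \<wr>\<wr> H)"
      using u by (auto simp: unrestricted_wreath_product_def PiE_iff)
    moreover have "?v \<otimes>\<^bsub>G \<wr>\<wr> H\<^esub> u = \<one>\<^bsub>G \<wr>\<wr> H\<^esub>"
      using u by (auto simp: unrestricted_wreath_product_def PiE_iff fun_eq_iff simp flip: H.m_assoc)
    ultimately show "\<exists>v\<in>carrier (G \<wr>\<wr> H). v \<otimes>\<^bsub>G \<wr>\<wr> H\<^esub> u = \<one>\<^bsub>G \<wr>\<wr> H\<^esub>"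
      by blast
    show "\<one>\<^bsub>G \<wr>\<wr> H\<^esub> \<otimes>\<^bsub>G \<wr>\<wr> H\<^esub> u = u"
      using u by (auto simp: unrestricted_wreath_product_def PiE_iff extensional_def fun_eq_iff)
  qed (auto simp: unrestricted_wreath_product_def PiE_iff G.m_assoc H.m_assoc intro!: restrict_ext)
qed

text \<open>
  The kernel of the projection to \<open>H\<close> consists of the pairs with second component \<open>\<one>\<^bsub>H\<^esub>\<close>. For these the
  shift in the multiplication is trivial, so the first component embeds the kernel into the direct
  product of copies of \<open>G\<close>.
\<close>
theorem theorem1:
  fixes G :: "('a, 'm) monoid_scheme" and H :: "('b, 'n) monoid_scheme"
  assumes "sofic_group G" and "amenable_group H"
  shows "sofic_group (G \<wr>\<wr> H)"
proof -
  let ?N = "kernel (G \<wr>\<wr> H) H snd"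
  have "group G" "group H"
    using assms by (auto simp: sofic_group_def amenable_group_def)
  interpret G: group G by fact
  interpret H: group H by fact
  have wreath: "group (G \<wr>\<wr> H)"
    using \<open>group G\<close> \<open>group H\<close> by (rule group_unrestricted_wreath_product)
  have "carrier H \<rightarrow>\<^sub>E carrier G \<noteq> {}"
    by (auto simp: PiE_eq_empty_iff)
  then have "snd ` carrier (G \<wr>\<wr> H) = carrier H"
    by (simp add: unrestricted_wreath_product_def)
  moreover have "snd \<in> hom (G \<wr>\<wr> H) H"
    by (auto simp: hom_def unrestricted_wreath_product_def)
  ultimately have snd: "snd \<in> epi (G \<wr>\<wr> H) H"
    by (simp add: epi_def)
  then interpret group_hom "G \<wr>\<wr> H" H snd
    using wreath by (simp add: group_hom_def group_hom_axioms_def epi_def \<open>group H\<close>)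
  have "group ((G \<wr>\<wr> H)\<lparr>carrier := ?N\<rparr>)"
    using subgroup_kernel wreath by (simp add: subgroup.subgroup_is_group)
  moreover have "fst \<in> mon ((G \<wr>\<wr> H)\<lparr>carrier := ?N\<rparr>) (product_group (carrier H) (\<lambda>_. G))"
    by (auto simp: mon_def hom_def kernel_def unrestricted_wreath_product_def inj_on_def PiE_iff
        intro!: restrict_ext)
  moreover have "sofic_group (product_group (carrier H) (\<lambda>_. G))"
    using assms(1) by (rule sofic_product_group)
  ultimately have "sofic_group ((G \<wr>\<wr> H)\<lparr>carrier := ?N\<rparr>)"
    by (rule sofic_group_mon)
  with wreath snd show ?thesis
    using assms(2) by (rule sofic_extension_by_amenable)
qed

end
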